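(* Let $n$ be a positive integer, let $X,Y\in M_n(\mathbb{C})$ be Hermitian matrices, and let $f$ be a continuous, convex, real-valued function on an interval $I\subseteq\mathbb{R}$ containing the numerical ranges of $X$ and $Y$. Suppose that $f$ is strictly increasing on $I$ or strictly decreasing on $I$. If $$\langle f(X)\xi,\xi\rangle\geq f(\langle Y\xi,\xi\rangle)\quad\text{and}\quad \langle f(Y)\xi,\xi\rangle\geq f(\langle X\xi,\xi\rangle)$$ for every unit vector $\xi\in\mathbb{C}^n$, then $X=Y$.
   Context: $\langle\cdot,\cdot\rangle$ is the standard inner product on $\mathbb{C}^n$. The numerical range of a Hermitian matrix $A$ is $\{\langle A\xi,\xi\rangle : \xi\in\mathbb{C}^n,\ \|\xi\|=1\}$. $f(A)$ is defined by the functional calculus for Hermitian matrices. *)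

theory Defs
  imports
    "HOL-Analysis.Convex"
    "HOL-Analysis.Topology_Euclidean_Space"
    "Jordan_Normal_Form.Schur_Decomposition"
begin

text \<open>
  Vectors in \<open>\<complex>\<^sup>n\<close> and matrices in \<open>M\<^sub>n(\<complex>)\<close> are elements of \<open>carrier_vec n\<close> and
  \<open>carrier_mat n n\<close>; the standard inner product is \<open>v \<bullet>c w\<close>, which is linear in \<open>v\<close>
  and conjugate-linear in \<open>w\<close>.
\<close>

definition hermitian_mat :: "complex mat \<Rightarrow> bool" where
  "hermitian_mat A \<longleftrightarrow> square_mat A \<and> mat_adjoint A = A"

definition unitary_mat :: "complex mat \<Rightarrow> bool" where
  "unitary_mat U \<longleftrightarrow> square_mat U \<and>
     U * mat_adjoint U = 1\<^sub>m (dim_row U) \<and> mat_adjoint U * U = 1\<^sub>m (dim_row U)"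

definition cvec_norm :: "complex vec \<Rightarrow> real" where
  "cvec_norm v = sqrt (Re (v \<bullet>c v))"

definition numerical_range :: "complex mat \<Rightarrow> complex set" where
  "numerical_range A =
     {(A *\<^sub>v \<xi>) \<bullet>c \<xi> | \<xi>. \<xi> \<in> carrier_vec (dim_row A) \<and> cvec_norm \<xi> = 1}"

text \<open>
  The functional calculus: if \<open>A = U diag(d) U\<^sup>*\<close> with \<open>U\<close> unitary and \<open>d\<close> real, then
  \<open>f(A) = U diag(f(d)) U\<^sup>*\<close>. The result does not depend on the diagonalization, see
  \<open>functional_calculus_rel_unique\<close> below; one exists for Hermitian \<open>A\<close> by the
  spectral theorem. Nothing is specified for other matrices.
\<close>

definition functional_calculus_rel :: "(real \<Rightarrow> real) \<Rightarrow> complex mat \<Rightarrow> complex mat \<Rightarrow> bool" where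
  "functional_calculus_rel f A B \<longleftrightarrow>
     (\<exists>U d. U \<in> carrier_mat (dim_row A) (dim_row A) \<and> unitary_mat U \<and>
        A = U * mat_diag (dim_row A) (\<lambda>i. complex_of_real (d i)) * mat_adjoint U \<and>
        B = U * mat_diag (dim_row A) (\<lambda>i. complex_of_real (f (d i))) * mat_adjoint U)"

definition functional_calculus :: "(real \<Rightarrow> real) \<Rightarrow> complex mat \<Rightarrow> complex mat" where
  "functional_calculus f A = (THE B. functional_calculus_rel f A B)"

lemma mat_adjoint_carrier:
  "A \<in> carrier_mat n m \<Longrightarrow> mat_adjoint A \<in> carrier_mat m n"
  by (auto simp: mat_adjoint_def)

lemma functional_calculus_rel_unique:
  assumes "functional_calculus_rel f A B" "functional_calculus_rel f A C"
  shows "B = C"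
proof -
  define n where "n = dim_row A"
  define D where "D = (\<lambda>g :: nat \<Rightarrow> real. mat_diag n (\<lambda>i. complex_of_real (g i)))"
  obtain U d where U: "U \<in> carrier_mat n n" "unitary_mat U"
    "A = U * D d * mat_adjoint U" "B = U * D (\<lambda>i. f (d i)) * mat_adjoint U"
    using assms(1) unfolding functional_calculus_rel_def n_def D_def by blast
  obtain V e where V: "V \<in> carrier_mat n n" "unitary_mat V"
    "A = V * D e * mat_adjoint V" "C = V * D (\<lambda>i. f (e i)) * mat_adjoint V"
    using assms(2) unfolding functional_calculus_rel_def n_def D_def by blast
  have D [simp]: "D g \<in> carrier_mat n n" for g by (simp add: D_def)
  define U' V' where "U' = mat_adjoint U" and "V' = mat_adjoint V"
  have c [simp]: "U \<in> carrier_mat n n" "V \<in> carrier_mat n n"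
      "U' \<in> carrier_mat n n" "V' \<in> carrier_mat n n"
    using U(1) V(1) mat_adjoint_carrier by (auto simp: U'_def V'_def)
  have u: "U * U' = 1\<^sub>m n" "U' * U = 1\<^sub>m n" "V * V' = 1\<^sub>m n" "V' * V = 1\<^sub>m n"
    using U(2) V(2) carrier_matD(1)[OF U(1)] carrier_matD(1)[OF V(1)]
    by (auto simp: unitary_mat_def U'_def V'_def)
  have A: "A = U * D d * U'" "A = V * D e * V'" using U(3) V(3) by (simp_all add: U'_def V'_def)
  have mult [simp]: "P * Q \<in> carrier_mat n n"
    if "P \<in> carrier_mat n n" "Q \<in> carrier_mat n n" for P Q :: "complex mat"
    using that by (rule mult_carrier_mat)
  note assoc = assoc_mult_mat[of _ n n _ n _ n] right_mult_one_mat[of _ n n]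
  have cancel: "V' * (V * M) = M" "V * (V' * M) = M" if "M \<in> carrier_mat n n" for M
    using that u by (simp_all flip: assoc(1))
  define W where "W = V' * U"
  have W [simp]: "W \<in> carrier_mat n n" unfolding W_def by simp
  have l: "V' * (U * D g * U') * U = W * D g" for g
    unfolding W_def using u by (simp add: assoc)
  have r: "V' * (V * D g * V') * U = D g * W" for g
    unfolding W_def by (simp add: assoc cancel)
  have "W * D d = D e * W"
    using l[of d] r[of e] A by metis
  then have eq: "mat n n (\<lambda>(i,j). W $$ (i,j) * complex_of_real (d j)) =
      mat n n (\<lambda>(i,j). complex_of_real (e i) * W $$ (i,j))"
    unfolding D_def mat_diag_mult_left[OF W] mat_diag_mult_right[OF W] .
  have "W $$ (i,j) * complex_of_real (f (d j)) = complex_of_real (f (e i)) * W $$ (i,j)"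
    if "i < n" "j < n" for i j
  proof (cases "W $$ (i,j) = 0")
    case False
    have "W $$ (i,j) * complex_of_real (d j) = complex_of_real (e i) * W $$ (i,j)"
      using arg_cong[OF eq, of "\<lambda>M. M $$ (i,j)"] that by simp
    with False have "d j = e i" by simp
    then show ?thesis by simp
  qed simp
  then have "W * D (\<lambda>i. f (d i)) = D (\<lambda>i. f (e i)) * W"
    unfolding D_def mat_diag_mult_left[OF W] mat_diag_mult_right[OF W]
    by (intro eq_matI) auto
  then have *: "V' * B * U = V' * C * U"
    using l r U(4) V(4) by (simp add: U'_def V'_def)
  have BC: "B \<in> carrier_mat n n" "C \<in> carrier_mat n n"
    using U(4) V(4) c D by (auto simp flip: U'_def V'_def)
  have "V * (V' * M * U) * U' = M" if "M \<in> carrier_mat n n" for M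
    using u that by (simp add: assoc cancel)
  then show ?thesis using * BC by metis
qed

end

theory Submission
  imports Defs "Jordan_Normal_Form.Spectral_Radius"
begin

text \<open>
  The idea is to test the two inequalities at eigenvectors. Diagonalize \<open>X\<close> and \<open>Y\<close> in
  orthonormal bases \<open>u\<^sub>i\<close>, \<open>v\<^sub>j\<close> with eigenvalues \<open>d\<^sub>i\<close>, \<open>e\<^sub>j\<close>, and let \<open>f\<close> be increasing.
  As \<open>f(X) u\<^sub>i = f(d\<^sub>i) u\<^sub>i\<close>, the first inequality at \<open>u\<^sub>i\<close> reads
  \<open>f(d\<^sub>i) \<ge> f(\<langle>Y u\<^sub>i, u\<^sub>i\<rangle>)\<close>, that is \<open>\<langle>Y u\<^sub>i, u\<^sub>i\<rangle> \<le> d\<^sub>i\<close>; the second one at \<open>v\<^sub>j\<close> gives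
  \<open>\<langle>X v\<^sub>j, v\<^sub>j\<rangle> \<le> e\<^sub>j\<close>. If \<open>f\<close> is decreasing, both inequalities are reversed
  (\<open>eigenbasis_test\<close>).

  Put \<open>s\<^sub>i\<^sub>j = |\<langle>v\<^sub>j, u\<^sub>i\<rangle>|\<^sup>2\<close>. This matrix is doubly stochastic, and
  \<open>\<langle>Y u\<^sub>i, u\<^sub>i\<rangle> = \<Sum>\<^sub>j s\<^sub>i\<^sub>j e\<^sub>j\<close>, \<open>\<langle>X v\<^sub>j, v\<^sub>j\<rangle> = \<Sum>\<^sub>i s\<^sub>i\<^sub>j d\<^sub>i\<close>
  (\<open>quadratic_form_transition\<close>). Summing the inequalities gives
  \<open>\<Sum> e \<le> \<Sum> d \<le> \<Sum> e\<close> (the traces of \<open>X\<close> and \<open>Y\<close>), so each of them is an equality. Then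
  \<open>\<Sum>\<^sub>i\<^sub>j s\<^sub>i\<^sub>j (d\<^sub>i - e\<^sub>j)\<^sup>2\<close>, which is the squared Hilbert-Schmidt norm of \<open>X - Y\<close>, vanishes
  (\<open>doubly_stochastic_sandwich\<close>): eigenvectors for different eigenvalues are orthogonal, and
  this forces \<open>X = Y\<close> (\<open>spectral_matrices_eqI\<close>).

  The spectral theorem for Hermitian matrices is proved by induction on the size, splitting
  off one eigenvector at a time (\<open>hermitian_spectral\<close>).
\<close>

section \<open>Adjoints and unitary matrices\<close>

lemma index_mat_adjoint [simp]:
  "i < dim_col A \<Longrightarrow> j < dim_row A \<Longrightarrow> mat_adjoint A $$ (i, j) = conjugate (A $$ (j, i))"
  by (simp add: mat_adjoint_def mat_of_rows_def)

lemma dim_mat_adjoint [simp]: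
  "dim_row (mat_adjoint A) = dim_col A" "dim_col (mat_adjoint A) = dim_row A"
  by (simp_all add: mat_adjoint_def)

lemma mat_adjoint_adjoint [simp]: "mat_adjoint (mat_adjoint A) = A"
  by (rule eq_matI) auto

lemma mat_adjoint_one [simp]: "mat_adjoint (1\<^sub>m n :: complex mat) = 1\<^sub>m n"
  by (rule eq_matI) auto

lemma mat_adjoint_zero [simp]: "mat_adjoint (0\<^sub>m n m :: complex mat) = 0\<^sub>m m n"
  by (rule eq_matI) auto

lemma mat_adjoint_mult:
  fixes A B :: "'a :: conjugatable_field mat"
  assumes "dim_col A = dim_row B"
  shows "mat_adjoint (A * B) = mat_adjoint B * mat_adjoint A"
  using assms
  by (intro eq_matI) (auto simp: scalar_prod_def sum_conjugate conjugate_dist_mul mult.commute)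

lemma mat_adjoint_four_block:
  assumes "A \<in> carrier_mat k k" "B \<in> carrier_mat k l" "C \<in> carrier_mat l k" "D \<in> carrier_mat l l"
  shows "mat_adjoint (four_block_mat A B C D)
       = four_block_mat (mat_adjoint A) (mat_adjoint C) (mat_adjoint B) (mat_adjoint D)"
  using assms by (intro eq_matI) auto

text \<open>For square matrices a left inverse is a right inverse, so one of the two equations is enough.\<close>
lemma unitary_matI:
  assumes "U \<in> carrier_mat n n" "mat_adjoint U * U = 1\<^sub>m n"
  shows "unitary_mat U"
proof -
  have "U * mat_adjoint U = 1\<^sub>m n"
    using assms mat_mult_left_right_inverse mat_adjoint_carrier by blast
  with assms show ?thesis by (auto simp: unitary_mat_def)
qed

lemma unitary_matD:
  assumes "unitary_mat U" "U \<in> carrier_mat n n"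
  shows "U * mat_adjoint U = 1\<^sub>m n" "mat_adjoint U * U = 1\<^sub>m n"
  using assms by (auto simp: unitary_mat_def)

lemma unitary_conj_cancel:
  fixes A :: "complex mat"
  assumes "unitary_mat U" "U \<in> carrier_mat n n" "A \<in> carrier_mat n n"
  shows "U * (mat_adjoint U * A * U) * mat_adjoint U = A"
proof -
  have "U * (mat_adjoint U * A * U) * mat_adjoint U
      = (U * mat_adjoint U) * A * (U * mat_adjoint U)"
    by (simp only: assoc_mult_mat[of _ n n _ n _ n] assms mat_adjoint_carrier[OF assms(2)] mult_carrier_mat[of _ n n _ n])
  then show ?thesis using assms by (simp add: unitary_matD[OF assms(1,2)])
qed

lemma unitary_mat_mult:
  assumes U: "unitary_mat U" "U \<in> carrier_mat n n" and V: "unitary_mat V" "V \<in> carrier_mat n n"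
  shows "unitary_mat (U * V)"
proof (rule unitary_matI)
  note c = assms(2,4) mat_adjoint_carrier[OF U(2)] mat_adjoint_carrier[OF V(2)] mult_carrier_mat[of _ n n _ n]
  have dims: "dim_col U = dim_row V" using U(2) V(2) by simp
  have "mat_adjoint (U * V) * (U * V) = mat_adjoint V * (mat_adjoint U * U * V)"
    by (simp add: mat_adjoint_mult[OF dims] c assoc_mult_mat[of _ n n _ n _ n] del: assoc_mult_mat)
  also have "\<dots> = 1\<^sub>m n" using c by (simp add: unitary_matD[OF U] unitary_matD[OF V])
  finally show "mat_adjoint (U * V) * (U * V) = 1\<^sub>m n" .
qed (use assms in auto)

lemma hermitian_conj:
  assumes "hermitian_mat A" "A \<in> carrier_mat n n" "U \<in> carrier_mat n n"
  shows "hermitian_mat (mat_adjoint U * A * U)"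
proof -
  note c = assms(2,3) mat_adjoint_carrier[OF assms(3)] mult_carrier_mat[of _ n n _ n]
  show ?thesis
    using assms c by (simp add: hermitian_mat_def mat_adjoint_mult assoc_mult_mat[of _ n n _ n _ n])
qed

lemma unitary_mat_adjoint:
  assumes "unitary_mat U" "U \<in> carrier_mat n n"
  shows "unitary_mat (mat_adjoint U)"
  using assms by (intro unitary_matI[of _ n]) (simp_all add: mat_adjoint_carrier unitary_matD)

text \<open>
  With the column version, this makes the squared moduli of the entries of a unitary matrix a
  doubly stochastic matrix.
\<close>
lemma unitary_row_sum:
  assumes W: "unitary_mat W" "W \<in> carrier_mat n n" and i: "i < n"
  shows "(\<Sum>j<n. (cmod (W $$ (i, j)))\<^sup>2) = 1"
proof -
  have "complex_of_real (\<Sum>j<n. (cmod (W $$ (i, j)))\<^sup>2) = (W * mat_adjoint W) $$ (i, i)"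
    using W(2) i
    by (simp add: scalar_prod_def lessThan_atLeast0 of_real_sum complex_norm_square del: of_real_power)
  also have "\<dots> = 1" using i by (simp add: unitary_matD[OF W])
  finally show ?thesis by (simp only: of_real_eq_1_iff)
qed

lemma unitary_col_sum:
  assumes W: "unitary_mat W" "W \<in> carrier_mat n n" and j: "j < n"
  shows "(\<Sum>i<n. (cmod (W $$ (i, j)))\<^sup>2) = 1"
  using unitary_row_sum[OF unitary_mat_adjoint[OF W] mat_adjoint_carrier[OF W(2)] j] W(2) j by simp

section \<open>Quadratic forms and changes of basis\<close>

text \<open>
  The values of the quadratic form of \<open>A\<close> at the columns of \<open>U\<close> are the diagonal of \<open>A\<close> in
  the basis formed by these columns.
\<close>
lemma quadratic_form_col:
  fixes A U :: "'a :: conjugatable_field mat"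
  assumes "A \<in> carrier_mat n n" "U \<in> carrier_mat n n" "i < n"
  shows "(A *\<^sub>v col U i) \<bullet>c col U i = (mat_adjoint U * (A * U)) $$ (i, i)"
proof -
  have "row (mat_adjoint U) i = conjugate (col U i)"
    using assms by (intro eq_vecI) auto
  then have "(mat_adjoint U * (A * U)) $$ (i, i) = conjugate (col U i) \<bullet> (A *\<^sub>v col U i)"
    using assms by (auto simp: mult_mat_vec_def)
  also have "\<dots> = (A *\<^sub>v col U i) \<bullet>c col U i"
    using assms by (intro comm_scalar_prod[of _ n]) auto
  finally show ?thesis by simp
qed

lemma cvec_norm_col_unitary:
  assumes "unitary_mat U" "U \<in> carrier_mat n n" "i < n"
  shows "cvec_norm (col U i) = 1"
  using quadratic_form_col[of "1\<^sub>m n" n U i] assms unitary_matD[of U n]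
  by (simp add: cvec_norm_def)

text \<open>
  For unitary \<open>V\<close>, whose columns are an eigenbasis of \<open>A\<close>, the vector \<open>col U i\<close> has the coordinates
  \<open>cnj (W $$ (i, j))\<close>, where \<open>W = U\<^sup>* V\<close> is the transition matrix; so the quadratic form is
  the average of the eigenvalues with the weights \<open>|W $$ (i, j)|\<^sup>2\<close>.
\<close>
lemma quadratic_form_transition:
  fixes e :: "nat \<Rightarrow> real"
  assumes U: "U \<in> carrier_mat n n" and V: "V \<in> carrier_mat n n" and i: "i < n"
    and A: "A = V * mat_diag n (\<lambda>j. complex_of_real (e j)) * mat_adjoint V"
  shows "(A *\<^sub>v col U i) \<bullet>c col U i
       = of_real (\<Sum>j<n. (cmod ((mat_adjoint U * V) $$ (i, j)))\<^sup>2 * e j)"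
proof -
  define W where "W = mat_adjoint U * V"
  let ?E = "mat_diag n (\<lambda>j. complex_of_real (e j))"
  note c = U V mat_adjoint_carrier[OF U] mat_adjoint_carrier[OF V] mult_carrier_mat[of _ n n _ n] mat_diag_dim
  have W: "W \<in> carrier_mat n n" unfolding W_def by (intro c)
  have AC: "A \<in> carrier_mat n n" unfolding A by (intro c)
  have W': "mat_adjoint W = mat_adjoint V * U"
    using U V mat_adjoint_mult[of "mat_adjoint U" V] by (simp add: W_def)
  have "mat_adjoint U * (A * U) = W * ?E * mat_adjoint W"
    unfolding W' unfolding A W_def by (simp add: c assoc_mult_mat[of _ n n _ n _ n] del: assoc_mult_mat)
  also have "(W * ?E * mat_adjoint W) $$ (i, i) = (\<Sum>j<n. W $$ (i, j) * e j * cnj (W $$ (i, j)))"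
    using W i by (simp add: mat_diag_mult_right[OF W] scalar_prod_def lessThan_atLeast0)
  also have "\<dots> = of_real (\<Sum>j<n. (cmod (W $$ (i, j)))\<^sup>2 * e j)"
    by (simp add: of_real_sum complex_norm_square mult_ac del: of_real_power)
  finally show ?thesis
    using quadratic_form_col[OF AC U i] by (simp add: W_def)
qed

lemma quadratic_form_eigenvector:
  fixes d :: "nat \<Rightarrow> real"
  assumes U: "unitary_mat U" "U \<in> carrier_mat n n" and i: "i < n"
    and A: "A = U * mat_diag n (\<lambda>j. complex_of_real (d j)) * mat_adjoint U"
  shows "(A *\<^sub>v col U i) \<bullet>c col U i = of_real (d i)"
proof -
  have "(cmod ((mat_adjoint U * U) $$ (i, j)))\<^sup>2 * d j = (if i = j then d j else 0)" if "j < n" for j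
    using i that by (simp add: unitary_matD[OF U])
  then show ?thesis
    unfolding quadratic_form_transition[OF U(2) U(2) i A] using i by simp
qed

section \<open>The spectral theorem\<close>

lemma scalar_self_complex:
  fixes v :: "complex vec"
  shows "v \<bullet>c v = of_real (\<Sum>i<dim_vec v. (cmod (v $ i))\<^sup>2)"
  by (simp add: scalar_prod_def lessThan_atLeast0 of_real_sum complex_norm_square del: of_real_power)

text \<open>
  Gram-Schmidt, started at \<open>v\<close>, gives an orthogonal basis; its vectors still have to be
  normalized, which only rescales \<open>v\<close>.
\<close>
lemma unitary_extension:
  fixes v :: "complex vec"
  assumes v: "v \<in> carrier_vec n" and v0: "v \<noteq> 0\<^sub>v n"
  obtains W c where "W \<in> carrier_mat n n" "unitary_mat W" "col W 0 = c \<cdot>\<^sub>v v"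
proof -
  interpret cof_vec_space n "TYPE(complex)" .
  have n: "n \<noteq> 0" using v v0 by (intro notI) (auto)
  define ws where "ws = gram_schmidt n (basis_completion v)"
  note b = basis_completion[OF v v0]
  have ws: "corthogonal ws" "set ws \<subseteq> carrier_vec n" "length ws = n"
    using gram_schmidt_result[OF b(2) b(4) b(5) ws_def] b(6) by auto
  obtain vs where "basis_completion v = v # vs"
    using b(6,7) n by (cases "basis_completion v") auto
  then have hd: "ws ! 0 = v"
    using gram_schmidt_hd[OF v, of vs] ws(3) n by (cases ws) (auto simp: ws_def)
  define c where "c w = complex_of_real (1 / cvec_norm w)" for w
  define W where "W = mat_of_cols n (map (\<lambda>w. c w \<cdot>\<^sub>v w) ws)"
  have W: "W \<in> carrier_mat n n" using ws mat_of_cols_carrier(1)[of n "map (\<lambda>w. c w \<cdot>\<^sub>v w) ws"] by (simp add: W_def)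
  have wsi: "ws ! i \<in> carrier_vec n" if "i < n" for i using ws that by auto
  have colW: "col W i = c (ws ! i) \<cdot>\<^sub>v ws ! i" if "i < n" for i
    using ws that wsi[OF that] by (simp add: W_def col_mat_of_cols)
  have "mat_adjoint W * W = 1\<^sub>m n"
  proof (rule eq_matI)
    fix i j assume "i < dim_row (1\<^sub>m n :: complex mat)" "j < dim_col (1\<^sub>m n :: complex mat)"
    then have ij: "i < n" "j < n" by auto
    have "row (mat_adjoint W) i = conjugate (col W i)"
      using W ij by (intro eq_vecI) auto
    then have "(mat_adjoint W * W) $$ (i, j) = conjugate (col W i) \<bullet> col W j"
      using W ij by auto
    also have "\<dots> = col W j \<bullet>c col W i"
      using W ij by (intro comm_scalar_prod[of _ n]) auto
    also have "\<dots> = c (ws ! j) * c (ws ! i) * (ws ! j \<bullet>c ws ! i)"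
      using ij wsi[OF ij(1)] wsi[OF ij(2)] by (simp add: colW conjugate_smult_vec c_def)
    also have "\<dots> = 1\<^sub>m n $$ (i, j)"
    proof (cases "i = j")
      case True
      define s where "s = (\<Sum>k<dim_vec (ws ! i). (cmod (ws ! i $ k))\<^sup>2)"
      have s: "ws ! i \<bullet>c ws ! i = of_real s" by (simp add: s_def scalar_self_complex)
      have "s \<ge> 0" unfolding s_def by (intro sum_nonneg) auto
      moreover have "s \<noteq> 0" using s corthogonalD[OF ws(1), of i i] ws(3) ij by auto
      ultimately have "1 / sqrt s * (1 / sqrt s) * s = 1" by (simp add: field_simps)
      then have "complex_of_real (1 / sqrt s * (1 / sqrt s) * s) = 1" by (simp only: of_real_1)
      then have "c (ws ! i) * c (ws ! i) * (ws ! i \<bullet>c ws ! i) = 1"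
        unfolding c_def cvec_norm_def s by (simp only: of_real_mult Re_complex_of_real)
      then show ?thesis using True ij by simp
    next
      case False
      then show ?thesis using corthogonalD[OF ws(1), of j i] ws(3) ij by auto
    qed
    finally show "(mat_adjoint W * W) $$ (i, j) = 1\<^sub>m n $$ (i, j)" .
  qed (use W in auto)
  with W have "unitary_mat W" by (rule unitary_matI)
  with W colW[of 0] n hd show ?thesis by (intro that) auto
qed

lemma block_diag_mult:
  fixes A B C D :: "'a :: semiring_1 mat"
  assumes "A \<in> carrier_mat k k" "B \<in> carrier_mat k k" "C \<in> carrier_mat l l" "D \<in> carrier_mat l l"
  shows "four_block_mat A (0\<^sub>m k l) (0\<^sub>m l k) C * four_block_mat B (0\<^sub>m k l) (0\<^sub>m l k) D
       = four_block_mat (A * B) (0\<^sub>m k l) (0\<^sub>m l k) (C * D)"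
  using mult_four_block_mat[OF assms(1) zero_carrier_mat zero_carrier_mat assms(3)
      assms(2) zero_carrier_mat zero_carrier_mat assms(4)] assms
  by simp

lemma mat_diag_Suc:
  "mat_diag (Suc n) f = four_block_mat (mat_diag 1 f) (0\<^sub>m 1 n) (0\<^sub>m n 1) (mat_diag n (\<lambda>i. f (Suc i)))"
  by (intro eq_matI) (auto simp: mat_diag_def)

text \<open>
  Let \<open>W\<close> be unitary with an eigenvector of \<open>A\<close> as its first column. Then the first column of
  \<open>B = W\<^sup>* A W\<close> is zero below the diagonal. As \<open>B\<close> is Hermitian again, its first row is zero
  right of the diagonal, the eigenvalue is real, and the remaining block is a smaller Hermitian
  matrix, to which the induction hypothesis applies.
\<close>
lemma hermitian_spectral:
  assumes "A \<in> carrier_mat n n" "hermitian_mat A"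
  shows "\<exists>U d. U \<in> carrier_mat n n \<and> unitary_mat U \<and>
           A = U * mat_diag n (\<lambda>i. complex_of_real (d i)) * mat_adjoint U"
  using assms
proof (induction n arbitrary: A)
  case 0
  have "unitary_mat (1\<^sub>m 0)" by (rule unitary_matI[of _ 0]) auto
  moreover have "A = 1\<^sub>m 0 * mat_diag 0 (\<lambda>i. complex_of_real 0) * mat_adjoint (1\<^sub>m 0)"
    using 0 by (intro eq_matI) auto
  ultimately show ?case by (intro exI[of _ "1\<^sub>m 0"] exI[of _ "\<lambda>_. 0"] conjI) auto
next
  case (Suc n)
  note A = Suc.prems(1)
  obtain e v where ev: "eigenvector A v e"
    using spectrum_non_empty[OF A] by (auto simp: spectrum_def eigenvalue_def)
  then have v: "v \<in> carrier_vec (Suc n)" "v \<noteq> 0\<^sub>v (Suc n)" "A *\<^sub>v v = e \<cdot>\<^sub>v v"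
    using A by (auto simp: eigenvector_def)
  obtain W c where W: "W \<in> carrier_mat (Suc n) (Suc n)" "unitary_mat W" and W0: "col W 0 = c \<cdot>\<^sub>v v"
    using unitary_extension[OF v(1,2)] by blast
  define B where "B = mat_adjoint W * A * W"
  have B: "B \<in> carrier_mat (Suc n) (Suc n)"
    using W(1) A by (auto simp: B_def mat_adjoint_carrier)
  have herm: "B $$ (i, j) = cnj (B $$ (j, i))" if "i < Suc n" "j < Suc n" for i j
  proof -
    have "mat_adjoint B = B"
      using hermitian_conj[OF Suc.prems(2) A W(1)] by (simp add: hermitian_mat_def B_def)
    then have "B $$ (i, j) = mat_adjoint B $$ (i, j)" by simp
    with B that show ?thesis by simp
  qed
  have col0: "B $$ (i, 0) = (if i = 0 then e else 0)" if "i < Suc n" for i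
  proof -
    have "A *\<^sub>v col W 0 = e \<cdot>\<^sub>v col W 0"
      using A v by (simp add: W0 mult_mat_vec[OF A v(1)] smult_smult_assoc mult.commute)
    then have "mat_adjoint W *\<^sub>v (A *\<^sub>v col W 0) = e \<cdot>\<^sub>v (mat_adjoint W *\<^sub>v col W 0)"
      using W0 v(1) mult_mat_vec[OF mat_adjoint_carrier[OF W(1)], of "col W 0" e] by simp
    moreover have "col B 0 = mat_adjoint W *\<^sub>v (A *\<^sub>v col W 0)"
      unfolding B_def assoc_mult_mat[OF mat_adjoint_carrier[OF W(1)] A W(1)]
      using A W(1) by (simp only: col_mult2[OF mat_adjoint_carrier[OF W(1)] mult_carrier_mat[OF A W(1)]] col_mult2[OF A W(1)] zero_less_Suc)
    ultimately have "col B 0 = e \<cdot>\<^sub>v (mat_adjoint W *\<^sub>v col W 0)" by simp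
    also have "mat_adjoint W *\<^sub>v col W 0 = col (mat_adjoint W * W) 0"
      by (simp add: col_mult2[OF mat_adjoint_carrier[OF W(1)] W(1)])
    also have "\<dots> = unit_vec (Suc n) 0"
      by (simp add: unitary_matD[OF W(2,1)])
    finally have "col B 0 $ i = (e \<cdot>\<^sub>v unit_vec (Suc n) 0) $ i" by simp
    with B that show ?thesis by simp
  qed
  have e: "complex_of_real (Re e) = e"
    using herm[of 0 0] col0[of 0] by (simp add: complex_eq_iff)
  define C where "C = mat n n (\<lambda>(i, j). B $$ (Suc i, Suc j))"
  have C: "C \<in> carrier_mat n n" by (simp add: C_def)
  have Bblock: "B = four_block_mat (mat 1 1 (\<lambda>_. e)) (0\<^sub>m 1 n) (0\<^sub>m n 1) C"
  proof (rule eq_matI)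
    fix i j assume "i < dim_row (four_block_mat (mat 1 1 (\<lambda>_. e)) (0\<^sub>m 1 n) (0\<^sub>m n 1) C)"
      "j < dim_col (four_block_mat (mat 1 1 (\<lambda>_. e)) (0\<^sub>m 1 n) (0\<^sub>m n 1) C)"
    then have "i < Suc n" "j < Suc n" using C by auto
    then show "B $$ (i, j) = four_block_mat (mat 1 1 (\<lambda>_. e)) (0\<^sub>m 1 n) (0\<^sub>m n 1) C $$ (i, j)"
      using C col0[of i] col0[of j] herm[of 0 j] by (cases i; cases j) (auto simp: C_def)
  qed (use B C in auto)
  have "mat_adjoint C = C"
  proof (rule eq_matI)
    fix i j assume "i < dim_row C" "j < dim_col C"
    then show "mat_adjoint C $$ (i, j) = C $$ (i, j)"
      using herm[of "Suc i" "Suc j"] by (simp add: C_def)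
  qed (use C in auto)
  then have "hermitian_mat C" using C by (auto simp: hermitian_mat_def)
  then obtain V d where V: "V \<in> carrier_mat n n" "unitary_mat V"
    and CV: "C = V * mat_diag n (\<lambda>i. complex_of_real (d i)) * mat_adjoint V"
    using Suc.IH[OF C] by blast
  have V': "mat_adjoint V \<in> carrier_mat n n" using V by (simp add: mat_adjoint_carrier)
  \<comment> \<open>\<open>P\<close> diagonalizes \<open>B\<close>, so \<open>W * P\<close> diagonalizes \<open>A\<close>.\<close>
  define P where "P = four_block_mat (1\<^sub>m 1) (0\<^sub>m 1 n) (0\<^sub>m n 1) V"
  define D where "D = mat_diag (Suc n) (\<lambda>i. complex_of_real (case_nat (Re e) d i))"
  have P: "P \<in> carrier_mat (Suc n) (Suc n)" using V by (auto simp: P_def)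
  have D: "D \<in> carrier_mat (Suc n) (Suc n)" by (auto simp: D_def)
  have P': "mat_adjoint P = four_block_mat (1\<^sub>m 1) (0\<^sub>m 1 n) (0\<^sub>m n 1) (mat_adjoint V)"
    unfolding P_def using V by (subst mat_adjoint_four_block[of _ 1 _ n]) auto
  have "mat_adjoint P * P = four_block_mat (1\<^sub>m 1) (0\<^sub>m 1 n) (0\<^sub>m n 1) (1\<^sub>m n)"
    unfolding P' unfolding P_def block_diag_mult[OF one_carrier_mat one_carrier_mat V' V(1)]
    by (simp add: unitary_matD[OF V(2,1)])
  also have "\<dots> = 1\<^sub>m (Suc n)" by (intro eq_matI) auto
  finally have P_unitary: "unitary_mat P" using P by (intro unitary_matI)
  have De: "D = four_block_mat (mat 1 1 (\<lambda>_. e)) (0\<^sub>m 1 n) (0\<^sub>m n 1) (mat_diag n (\<lambda>i. complex_of_real (d i)))"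
    unfolding D_def mat_diag_Suc using e by (intro cong_four_block_mat) (auto simp: mat_diag_def)
  have M: "mat 1 1 (\<lambda>_. e) \<in> carrier_mat 1 1" by simp
  have PD: "P * D = four_block_mat (mat 1 1 (\<lambda>_. e)) (0\<^sub>m 1 n) (0\<^sub>m n 1)
      (V * mat_diag n (\<lambda>i. complex_of_real (d i)))"
    unfolding P_def De block_diag_mult[OF one_carrier_mat M V(1) mat_diag_dim]
    by (simp only: left_mult_one_mat[OF M])
  have BP: "P * D * mat_adjoint P = B"
    unfolding PD P' Bblock CV
      block_diag_mult[OF M one_carrier_mat mult_carrier_mat[OF V(1) mat_diag_dim] V']
    by (simp only: right_mult_one_mat[OF M])
  have WP: "W * P \<in> carrier_mat (Suc n) (Suc n)" using W(1) P by (rule mult_carrier_mat)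
  have WP': "mat_adjoint (W * P) = mat_adjoint P * mat_adjoint W"
    using W(1) P by (intro mat_adjoint_mult) simp
  have "A = W * (P * D * mat_adjoint P) * mat_adjoint W"
    using unitary_conj_cancel[OF W(2,1) A] by (simp add: BP B_def)
  also have "\<dots> = (W * P) * D * mat_adjoint (W * P)"
    unfolding WP'
    by (simp only: assoc_mult_mat[of _ "Suc n" "Suc n" _ "Suc n" _ "Suc n"] W(1) P D
        mat_adjoint_carrier[OF W(1)] mat_adjoint_carrier[OF P]
        mult_carrier_mat[of _ "Suc n" "Suc n" _ "Suc n"])
  finally show ?case
    using unitary_mat_mult[OF W(2,1) P_unitary P] WP unfolding D_def by blast
qed

section \<open>Rigidity\<close>

text \<open>
  Each of the two vectors dominates the average of the other. Summing all these inequalities,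
  the two sides have the same total because \<open>s\<close> is doubly stochastic; so equality holds in each
  of them. Hence the cross terms in the expansion of \<open>\<Sum> s\<^sub>i\<^sub>j (d\<^sub>i - e\<^sub>j)\<^sup>2\<close> cancel the squares:
  \<open>\<Sum> s\<^sub>i\<^sub>j d\<^sub>i e\<^sub>j\<close> is both \<open>\<Sum> d\<^sub>i\<^sup>2\<close> and \<open>\<Sum> e\<^sub>j\<^sup>2\<close>.
\<close>
lemma doubly_stochastic_sandwich:
  fixes s :: "nat \<Rightarrow> nat \<Rightarrow> real" and d e :: "nat \<Rightarrow> real"
  assumes nonneg: "\<And>i j. i < n \<Longrightarrow> j < n \<Longrightarrow> 0 \<le> s i j"
    and row: "\<And>i. i < n \<Longrightarrow> (\<Sum>j<n. s i j) = 1"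
    and col: "\<And>j. j < n \<Longrightarrow> (\<Sum>i<n. s i j) = 1"
    and d: "\<And>i. i < n \<Longrightarrow> (\<Sum>j<n. s i j * e j) \<le> d i"
    and e: "\<And>j. j < n \<Longrightarrow> (\<Sum>i<n. s i j * d i) \<le> e j"
    and ij: "i < n" "j < n" "s i j \<noteq> 0"
  shows "d i = e j"
proof -
  define y where "y i = (\<Sum>j<n. s i j * e j)" for i
  define x where "x j = (\<Sum>i<n. s i j * d i)" for j
  have sx: "(\<Sum>j<n. x j * h j) = (\<Sum>i<n. \<Sum>j<n. s i j * d i * h j)" for h
    unfolding x_def by (subst sum.swap) (simp add: sum_distrib_right)
  have sy: "(\<Sum>i<n. y i * g i) = (\<Sum>i<n. \<Sum>j<n. s i j * e j * g i)" for g
    unfolding y_def by (simp add: sum_distrib_right)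
  have sd: "(\<Sum>i<n. \<Sum>j<n. s i j * g i) = (\<Sum>i<n. g i)" for g
    by (simp add: row flip: sum_distrib_right)
  have se: "(\<Sum>i<n. \<Sum>j<n. s i j * h j) = (\<Sum>j<n. h j)" for h
    by (subst sum.swap) (simp add: col flip: sum_distrib_right)
  have "(\<Sum>i<n. d i - y i) + (\<Sum>j<n. e j - x j) = 0"
    using sx[of "\<lambda>_. 1"] sy[of "\<lambda>_. 1"] sd[of d] se[of e] by (simp add: sum_subtractf)
  moreover have "0 \<le> (\<Sum>i<n. d i - y i)" "0 \<le> (\<Sum>j<n. e j - x j)"
    using d e by (auto intro!: sum_nonneg simp: x_def y_def)
  ultimately have "(\<Sum>i<n. d i - y i) = 0" "(\<Sum>j<n. e j - x j) = 0" by linarith+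
  then have yd: "y i = d i" and xe: "x i = e i" if "i < n" for i
    using d e that
    by (subst (asm) sum_nonneg_eq_0_iff; force simp: x_def y_def)+
  have "(\<Sum>i<n. \<Sum>j<n. s i j * (d i - e j)\<^sup>2)
      = (\<Sum>i<n. \<Sum>j<n. s i j * (d i)\<^sup>2) + (\<Sum>i<n. \<Sum>j<n. s i j * (e j)\<^sup>2)
        - (\<Sum>i<n. \<Sum>j<n. s i j * e j * d i) - (\<Sum>i<n. \<Sum>j<n. s i j * d i * e j)"
    unfolding sum.distrib[symmetric] sum_subtractf[symmetric]
    by (intro sum.cong refl) (simp add: power2_eq_square algebra_simps)
  also have "\<dots> = (\<Sum>i<n. (d i)\<^sup>2) + (\<Sum>j<n. (e j)\<^sup>2) - (\<Sum>i<n. y i * d i) - (\<Sum>j<n. x j * e j)"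
    by (simp only: sd se sx sy)
  also have "\<dots> = 0"
    by (simp add: yd xe power2_eq_square)
  finally have "(\<Sum>j<n. s i j * (d i - e j)\<^sup>2) = 0"
    using ij nonneg by (subst (asm) sum_nonneg_eq_0_iff) (auto intro!: sum_nonneg)
  then have "s i j * (d i - e j)\<^sup>2 = 0"
    using ij nonneg by (subst (asm) sum_nonneg_eq_0_iff) auto
  with ij show ?thesis by simp
qed

text \<open>Any diagonalization computes \<open>f(A)\<close>, since the result does not depend on it.\<close>
lemma functional_calculus_eq:
  assumes U: "unitary_mat U" "U \<in> carrier_mat n n"
    and A: "A = U * mat_diag n (\<lambda>i. complex_of_real (d i)) * mat_adjoint U"
  shows "functional_calculus f A = U * mat_diag n (\<lambda>i. complex_of_real (f (d i))) * mat_adjoint U"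
proof -
  have "dim_row A = n" using U A by simp
  then have "functional_calculus_rel f A (U * mat_diag n (\<lambda>i. complex_of_real (f (d i))) * mat_adjoint U)"
    unfolding functional_calculus_rel_def using U A by blast
  then show ?thesis
    unfolding functional_calculus_def by (blast intro: functional_calculus_rel_unique)
qed

lemma numerical_rangeD:
  assumes "numerical_range A \<subseteq> complex_of_real ` I" "A \<in> carrier_mat n n"
    and "\<xi> \<in> carrier_vec n" "cvec_norm \<xi> = 1"
  shows "Re ((A *\<^sub>v \<xi>) \<bullet>c \<xi>) \<in> I"
proof -
  have "(A *\<^sub>v \<xi>) \<bullet>c \<xi> \<in> numerical_range A"
    using assms by (auto simp: numerical_range_def)
  then show ?thesis using assms(1) by auto
qed

text \<open>
  At the eigenvector \<open>col U i\<close> the quadratic form of \<open>f(A)\<close> is \<open>f (d i)\<close>, so the hypothesis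
  compares two values of \<open>f\<close>, at points that lie in \<open>I\<close> because they belong to the numerical
  ranges; strict monotonicity cancels \<open>f\<close>.
\<close>
lemma eigenbasis_test:
  assumes U: "unitary_mat U" "U \<in> carrier_mat n n" and V: "V \<in> carrier_mat n n"
    and A: "A = U * mat_diag n (\<lambda>i. complex_of_real (d i)) * mat_adjoint U"
    and B: "B = V * mat_diag n (\<lambda>j. complex_of_real (e j)) * mat_adjoint V"
    and range: "numerical_range A \<subseteq> complex_of_real ` I" "numerical_range B \<subseteq> complex_of_real ` I"
    and le: "\<And>\<xi>. \<xi> \<in> carrier_vec n \<Longrightarrow> cvec_norm \<xi> = 1 \<Longrightarrow>
           f (Re ((B *\<^sub>v \<xi>) \<bullet>c \<xi>)) \<le> Re ((functional_calculus f A *\<^sub>v \<xi>) \<bullet>c \<xi>)"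
    and mono: "strict_mono_on I f \<or> strict_antimono_on I f"
    and i: "i < n"
  defines "y \<equiv> \<Sum>j<n. (cmod ((mat_adjoint U * V) $$ (i, j)))\<^sup>2 * e j"
  shows "if strict_mono_on I f then y \<le> d i else d i \<le> y"
proof -
  have AB: "A \<in> carrier_mat n n" "B \<in> carrier_mat n n"
    using U V by (auto simp: A B)
  have u: "col U i \<in> carrier_vec n" "cvec_norm (col U i) = 1"
    using U i cvec_norm_col_unitary by auto
  have y: "Re ((B *\<^sub>v col U i) \<bullet>c col U i) = y"
    by (simp add: quadratic_form_transition[OF U(2) V i B] y_def)
  have d: "Re ((A *\<^sub>v col U i) \<bullet>c col U i) = d i"
    by (simp add: quadratic_form_eigenvector[OF U i A])
  have "Re ((functional_calculus f A *\<^sub>v col U i) \<bullet>c col U i) = f (d i)"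
    by (simp add: quadratic_form_eigenvector[OF U i functional_calculus_eq[OF U A]])
  then have "f y \<le> f (d i)" using le[OF u] y by simp
  moreover have "y \<in> I" "d i \<in> I"
    using numerical_rangeD[OF range(2) AB(2) u] numerical_rangeD[OF range(1) AB(1) u] y d by auto
  ultimately show ?thesis
    using mono by (smt (verit) monotone_on_def)
qed

text \<open>
  The condition says that the transition matrix \<open>W = U\<^sup>* V\<close> intertwines the two diagonal
  matrices, \<open>D W = W E\<close>. Since \<open>V = U W\<close>, both sides are equal to \<open>U D W V\<^sup>*\<close>.
\<close>
lemma spectral_matrices_eqI:
  fixes d e :: "nat \<Rightarrow> complex"
  assumes U: "unitary_mat U" "U \<in> carrier_mat n n" and V: "unitary_mat V" "V \<in> carrier_mat n n"
    and eq: "\<And>i j. i < n \<Longrightarrow> j < n \<Longrightarrow> (mat_adjoint U * V) $$ (i, j) \<noteq> 0 \<Longrightarrow> d i = e j"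
  shows "U * mat_diag n d * mat_adjoint U = V * mat_diag n e * mat_adjoint V"
proof -
  define W where "W = mat_adjoint U * V"
  note c = U(2) V(2) mat_adjoint_carrier[OF U(2)] mat_adjoint_carrier[OF V(2)] mult_carrier_mat[of _ n n _ n] mat_diag_dim
  note assoc = assoc_mult_mat[of _ n n _ n _ n]
  have W: "W \<in> carrier_mat n n" unfolding W_def by (intro c)
  have DW: "mat_diag n d * W = W * mat_diag n e"
    unfolding mat_diag_mult_left[OF W] mat_diag_mult_right[OF W]
    using eq by (intro eq_matI) (auto simp: W_def)
  have "U * mat_diag n d * mat_adjoint U = U * (mat_diag n d * W) * mat_adjoint V"
  proof -
    have "W * mat_adjoint V = mat_adjoint U * (V * mat_adjoint V)"
      unfolding W_def by (simp add: c assoc del: assoc_mult_mat)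
    then have "W * mat_adjoint V = mat_adjoint U"
      using c by (simp add: unitary_matD[OF V])
    then show ?thesis using W by (simp add: c assoc del: assoc_mult_mat)
  qed
  also have "\<dots> = V * mat_diag n e * mat_adjoint V"
  proof -
    have "U * W = (U * mat_adjoint U) * V"
      unfolding W_def by (simp add: c assoc del: assoc_mult_mat)
    then have "U * W = V" using c by (simp add: unitary_matD[OF U])
    moreover have "U * (W * mat_diag n e) * mat_adjoint V = U * W * mat_diag n e * mat_adjoint V"
      using W by (simp add: c assoc del: assoc_mult_mat)
    ultimately show ?thesis by (simp add: DW)
  qed
  finally show ?thesis .
qed

section \<open>The theorem\<close>

theorem theorem2p1:
  fixes n :: nat and X Y :: "complex mat" and f :: "real \<Rightarrow> real" and I :: "real set"
  assumes "n > 0"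
    and "X \<in> carrier_mat n n" and "hermitian_mat X"
    and "Y \<in> carrier_mat n n" and "hermitian_mat Y"
    and "is_interval I"
    and "numerical_range X \<subseteq> complex_of_real ` I"
    and "numerical_range Y \<subseteq> complex_of_real ` I"
    and "continuous_on I f"
    and "convex_on I f"
    and "strict_mono_on I f \<or> strict_antimono_on I f"
    and "\<And>\<xi>. \<xi> \<in> carrier_vec n \<Longrightarrow> cvec_norm \<xi> = 1 \<Longrightarrow>
           Re ((functional_calculus f X *\<^sub>v \<xi>) \<bullet>c \<xi>) \<ge> f (Re ((Y *\<^sub>v \<xi>) \<bullet>c \<xi>))"
    and "\<And>\<xi>. \<xi> \<in> carrier_vec n \<Longrightarrow> cvec_norm \<xi> = 1 \<Longrightarrow>
           Re ((functional_calculus f Y *\<^sub>v \<xi>) \<bullet>c \<xi>) \<ge> f (Re ((X *\<^sub>v \<xi>) \<bullet>c \<xi>))"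
  shows "X = Y"
proof -
  obtain U d where U: "unitary_mat U" "U \<in> carrier_mat n n"
    and X: "X = U * mat_diag n (\<lambda>i. complex_of_real (d i)) * mat_adjoint U"
    using hermitian_spectral[OF assms(2,3)] by blast
  obtain V e where V: "unitary_mat V" "V \<in> carrier_mat n n"
    and Y: "Y = V * mat_diag n (\<lambda>j. complex_of_real (e j)) * mat_adjoint V"
    using hermitian_spectral[OF assms(4,5)] by blast
  define W where "W = mat_adjoint U * V"
  define s where "s i j = (cmod (W $$ (i, j)))\<^sup>2" for i j
  have W: "unitary_mat W" "W \<in> carrier_mat n n"
    unfolding W_def using U V
    by (auto intro!: unitary_mat_mult unitary_mat_adjoint mat_adjoint_carrier)
  have s_swap: "(cmod ((mat_adjoint V * U) $$ (j, i)))\<^sup>2 = s i j" if "i < n" "j < n" for i j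
  proof -
    have "mat_adjoint V * U = mat_adjoint W"
      using U V mat_adjoint_mult[of "mat_adjoint U" V] by (simp add: W_def)
    then show ?thesis using W that by (simp add: s_def)
  qed
  have row: "(\<Sum>j<n. s i j) = 1" and col: "(\<Sum>k<n. s k i) = 1" if "i < n" for i
    using unitary_row_sum[OF W that] unitary_col_sum[OF W that] by (simp_all add: s_def)
  have d: "if strict_mono_on I f then (\<Sum>j<n. s i j * e j) \<le> d i else d i \<le> (\<Sum>j<n. s i j * e j)"
    if "i < n" for i
    using eigenbasis_test[OF U V(2) X Y assms(7,8) assms(12) assms(11) that]
    by (simp add: s_def W_def)
  have e: "if strict_mono_on I f then (\<Sum>i<n. s i j * d i) \<le> e j else e j \<le> (\<Sum>i<n. s i j * d i)"
    if "j < n" for j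
  proof -
    have "(\<Sum>i<n. (cmod ((mat_adjoint V * U) $$ (j, i)))\<^sup>2 * d i) = (\<Sum>i<n. s i j * d i)"
      using that by (intro sum.cong) (simp_all only: s_swap lessThan_iff)
    then show ?thesis
      using eigenbasis_test[OF V U(2) Y X assms(8,7) assms(13) assms(11) that] by metis
  qed
  have "d i = e j" if ij: "i < n" "j < n" "s i j \<noteq> 0" for i j
  proof (cases "strict_mono_on I f")
    case True
    then show ?thesis
      using d e ij row col by (intro doubly_stochastic_sandwich[of n s e d]) (auto simp: s_def)
  next
    case False
    \<comment> \<open>For decreasing \<open>f\<close> all inequalities are reversed; negating the eigenvalues restores them.\<close>
    have "- d i = - e j"
      using d e ij row col False
      by (intro doubly_stochastic_sandwich[of n s "\<lambda>j. - e j" "\<lambda>i. - d i"])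
        (auto simp: s_def sum_negf)
    then show ?thesis by simp
  qed
  then show ?thesis
    unfolding X Y by (intro spectral_matrices_eqI[OF U V]) (auto simp: s_def W_def)
qed

end
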